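(* Let $\mathsf{JL}$ be one of $\mathsf{J},\mathsf{J4},\mathsf{JD},\mathsf{JD4},\mathsf{JT},\mathsf{LP}$ and let $\mathsf{CS}$ be a constant specification for $\mathsf{JL}$. Then all formulas (of the labeled language) in a derivation in $\mathsf{G3JL}_{\mathsf{CS}}$ are either labeled-subformulas of labeled formulas in the endsequent or atomic formulas of the form $wE(t,A)$ or $wRv$.
   Context: Justification logics. Terms are built from justification variables and constants by binary $\cdot,+$ and, if (j4) is an axiom, unary $!$. Formulas are built from propositional variables and $\bot$ by $\neg,\wedge,\vee,\to$ and $t:A$. $\mathsf J$ has axiom schemes: propositional tautologies; $s:A\to(s+t):A$, $s:A\to(t+s):A$; $s:(A\to B)\to(t:A\to(s\cdot t):B)$. Further schemes: (jT) $t:A\to A$, (jD) $t:\bot\to\bot$, (j4) $t:A\to\,!t:t:A$. The names list the added schemes, $\mathsf{LP}=\mathsf{JT4}$. A constant specification $\mathsf{CS}$: if (j4) is not an axiom, a set of formulas $c_n:\dots:c_1:A$ ($n\ge1$, $c_j$ constants, $A$ an axiom instance), closed under passing from $c_n:c_{n-1}:\dots:c_1:A$ to $c_{n-1}:\dots:c_1:A$; if (j4) is an axiom, a set of formulas $c:A$ ($c$ a constant, $A$ an axiom instance). Calculus $\mathsf{G3JL}_{\mathsf{CS}}$. Fix a countably infinite set of labels $w,v,u,\dots$. The labeled language has labeled formulas $w\Vvdash A$, relational atoms $wRv$ and evidence atoms $wE(t,A)$ ($A$ a formula, $t$ a term). Sequents $\Gamma\Rightarrow\Delta$ consist of finite multisets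 of these. Initial sequents: $w\Vvdash P,\Gamma\Rightarrow\Delta,w\Vvdash P$ ($P$ a propositional variable); $w\Vvdash\bot,\Gamma\Rightarrow\Delta$; $wRv,\Gamma\Rightarrow\Delta,wRv$; $wE(t,A),\Gamma\Rightarrow\Delta,wE(t,A)$. Rules (premises / conclusion): (L$\neg$) $\Gamma\Rightarrow\Delta,w\Vvdash A$ / $w\Vvdash\neg A,\Gamma\Rightarrow\Delta$; (R$\neg$) $w\Vvdash A,\Gamma\Rightarrow\Delta$ / $\Gamma\Rightarrow\Delta,w\Vvdash\neg A$; (L$\wedge$) $w\Vvdash A,w\Vvdash B,\Gamma\Rightarrow\Delta$ / $w\Vvdash A\wedge B,\Gamma\Rightarrow\Delta$; (R$\wedge$) $\Gamma\Rightarrow\Delta,w\Vvdash A$ and $\Gamma\Rightarrow\Delta,w\Vvdash B$ / $\Gamma\Rightarrow\Delta,w\Vvdash A\wedge B$; (L$\vee$) $w\Vvdash A,\Gamma\Rightarrow\Delta$ and $w\Vvdash B,\Gamma\Rightarrow\Delta$ / $w\Vvdash A\vee B,\Gamma\Rightarrow\Delta$; (R$\vee$) $\Gamma\Rightarrow\Delta,w\Vvdash A,w\Vvdash B$ / $\Gamma\Rightarrow\Delta,w\Vvdash A\vee B$; (L$\to$) $\Gamma\Rightarrow\Delta,w\Vvdash A$ and $w\Vvdash B,\Gamma\Rightarrow\Delta$ / $w\Vvdash A\to B,\Gamma\Rightarrow\Delta$; (R$\to$) $w\Vvdash A,\Gamma\Rightarrow\Delta,w\Vvdash B$ / $\Gamma\Rightarrow\Delta,w\Vvdash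 A\to B$; (L:) $v\Vvdash A,w\Vvdash t:A,wRv,\Gamma\Rightarrow\Delta$ / $w\Vvdash t:A,wRv,\Gamma\Rightarrow\Delta$; (R:) $wRv,wE(t,A),\Gamma\Rightarrow\Delta,v\Vvdash A$ / $wE(t,A),\Gamma\Rightarrow\Delta,w\Vvdash t:A$, where the eigenlabel $v$ does not occur in the conclusion; (E) $wE(t,A),w\Vvdash t:A,\Gamma\Rightarrow\Delta$ / $w\Vvdash t:A,\Gamma\Rightarrow\Delta$; (El+) $wE(s+t,A),wE(t,A),\Gamma\Rightarrow\Delta$ / $wE(t,A),\Gamma\Rightarrow\Delta$; (Er+) $wE(t+s,A),wE(t,A),\Gamma\Rightarrow\Delta$ / $wE(t,A),\Gamma\Rightarrow\Delta$; (E$\cdot$) $wE(s\cdot t,B),wE(s,A\to B),wE(t,A),\Gamma\Rightarrow\Delta$ / $wE(s,A\to B),wE(t,A),\Gamma\Rightarrow\Delta$; (IAN)/(AN) $wE(c,F),\Gamma\Rightarrow\Delta$ / $\Gamma\Rightarrow\Delta$, for $c:F\in\mathsf{CS}$ ($c$ a constant). If (jT) is an axiom: (Ref) $wRw,\Gamma\Rightarrow\Delta$ / $\Gamma\Rightarrow\Delta$. If (jD) is an axiom: (Ser) $wRv,\Gamma\Rightarrow\Delta$ / $\Gamma\Rightarrow\Delta$, where the eigenlabel $v$ does not occur in the conclusion. If (j4) is an axiom: (E!) $wE(!t,t:A),wE(t,A),\Gamma\Rightarrow\Delta$ / $wE(t,A),\Gamma\Rightarrow\Delta$; (Mon) $vE(t,A),wE(t,A),wRv,\Gamma\Rightarrow\Delta$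 / $wE(t,A),wRv,\Gamma\Rightarrow\Delta$; (Trans) $wRu,wRv,vRu,\Gamma\Rightarrow\Delta$ / $wRv,vRu,\Gamma\Rightarrow\Delta$. Labeled-subformulas of a labeled formula, inductively: $w\Vvdash P$ and $w\Vvdash\bot$ have only themselves; those of $w\Vvdash\neg A$ are itself and all those of $w\Vvdash A$; those of $w\Vvdash A\star B$ ($\star$ a binary connective) are itself and all those of $w\Vvdash A$ and $w\Vvdash B$; those of $w\Vvdash t:A$ are itself and all those of $v\Vvdash A$ for arbitrary labels $v$. *)

theory Defs
  imports "HOL-Library.Multiset"
begin

section \<open>Logics, terms and formulas\<close>

datatype logic = J | J4 | JD | JD4 | JT | LP

definition has_jT :: "logic \<Rightarrow> bool" where
  "has_jT L \<longleftrightarrow> L \<in> {JT, LP}"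

text \<open>In JT and LP the scheme (jD) is an instance of (jT), but it is not one of the
  axiom schemes of these logics, so their calculi do not have the rule (Ser).\<close>

definition has_jD :: "logic \<Rightarrow> bool" where
  "has_jD L \<longleftrightarrow> L \<in> {JD, JD4}"

definition has_j4 :: "logic \<Rightarrow> bool" where
  "has_j4 L \<longleftrightarrow> L \<in> {J4, JD4, LP}"

text \<open>The type parameters are the justification variables, the constants and the
  propositional variables.\<close>

datatype ('v, 'c) tm =
    JVar 'v
  | JConst 'c
  | JApp "('v, 'c) tm" "('v, 'c) tm"
  | JSum "('v, 'c) tm" "('v, 'c) tm"
  | JBang "('v, 'c) tm"

datatype ('v, 'c, 'p) fm =
    PVar 'p
  | Bot
  | Neg "('v, 'c, 'p) fm"
  | Conj "('v, 'c, 'p) fm" "('v, 'c, 'p) fm"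
  | Disj "('v, 'c, 'p) fm" "('v, 'c, 'p) fm"
  | Imp "('v, 'c, 'p) fm" "('v, 'c, 'p) fm"
  | Just "('v, 'c) tm" "('v, 'c, 'p) fm"

text \<open>The language of a logic: the operation \<open>!\<close> is available only in the presence
  of (j4).\<close>

primrec tm_in :: "logic \<Rightarrow> ('v, 'c) tm \<Rightarrow> bool" where
  "tm_in L (JVar x) \<longleftrightarrow> True"
| "tm_in L (JConst c) \<longleftrightarrow> True"
| "tm_in L (JApp s t) \<longleftrightarrow> tm_in L s \<and> tm_in L t"
| "tm_in L (JSum s t) \<longleftrightarrow> tm_in L s \<and> tm_in L t"
| "tm_in L (JBang t) \<longleftrightarrow> has_j4 L \<and> tm_in L t"

primrec fm_in :: "logic \<Rightarrow> ('v, 'c, 'p) fm \<Rightarrow> bool" where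
  "fm_in L (PVar P) \<longleftrightarrow> True"
| "fm_in L Bot \<longleftrightarrow> True"
| "fm_in L (Neg A) \<longleftrightarrow> fm_in L A"
| "fm_in L (Conj A B) \<longleftrightarrow> fm_in L A \<and> fm_in L B"
| "fm_in L (Disj A B) \<longleftrightarrow> fm_in L A \<and> fm_in L B"
| "fm_in L (Imp A B) \<longleftrightarrow> fm_in L A \<and> fm_in L B"
| "fm_in L (Just t A) \<longleftrightarrow> tm_in L t \<and> fm_in L A"


section \<open>Axioms and constant specifications\<close>

text \<open>For propositional tautologies, formulas \<open>t:A\<close> count as atoms; \<open>val\<close> assigns
  truth values to them and to the propositional variables.\<close>

primrec bool_eval :: "(('v, 'c, 'p) fm \<Rightarrow> bool) \<Rightarrow> ('v, 'c, 'p) fm \<Rightarrow> bool" where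
  "bool_eval val (PVar P) \<longleftrightarrow> val (PVar P)"
| "bool_eval val Bot \<longleftrightarrow> False"
| "bool_eval val (Neg A) \<longleftrightarrow> \<not> bool_eval val A"
| "bool_eval val (Conj A B) \<longleftrightarrow> bool_eval val A \<and> bool_eval val B"
| "bool_eval val (Disj A B) \<longleftrightarrow> bool_eval val A \<or> bool_eval val B"
| "bool_eval val (Imp A B) \<longleftrightarrow> (bool_eval val A \<longrightarrow> bool_eval val B)"
| "bool_eval val (Just t A) \<longleftrightarrow> val (Just t A)"

definition tautology :: "('v, 'c, 'p) fm \<Rightarrow> bool" where
  "tautology A \<longleftrightarrow> (\<forall>val. bool_eval val A)"

inductive axiom_scheme :: "logic \<Rightarrow> ('v, 'c, 'p) fm \<Rightarrow> bool" for L :: logic where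
  ax_taut: "tautology A \<Longrightarrow> axiom_scheme L A"
| ax_sum_left: "axiom_scheme L (Imp (Just s A) (Just (JSum s t) A))"
| ax_sum_right: "axiom_scheme L (Imp (Just s A) (Just (JSum t s) A))"
| ax_app: "axiom_scheme L
    (Imp (Just s (Imp A B)) (Imp (Just t A) (Just (JApp s t) B)))"
| ax_jT: "has_jT L \<Longrightarrow> axiom_scheme L (Imp (Just t A) A)"
| ax_jD: "has_jD L \<Longrightarrow> axiom_scheme L (Imp (Just t Bot) Bot)"
| ax_j4: "has_j4 L \<Longrightarrow> axiom_scheme L (Imp (Just t A) (Just (JBang t) (Just t A)))"

definition axiom_instance :: "logic \<Rightarrow> ('v, 'c, 'p) fm \<Rightarrow> bool" where
  "axiom_instance L A \<longleftrightarrow> axiom_scheme L A \<and> fm_in L A"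

text \<open>\<open>just_chain [c\<^sub>n, \<dots>, c\<^sub>1] A\<close> is \<open>c\<^sub>n:\<dots>:c\<^sub>1:A\<close>.\<close>

definition just_chain :: "'c list \<Rightarrow> ('v, 'c, 'p) fm \<Rightarrow> ('v, 'c, 'p) fm" where
  "just_chain cs A = foldr (\<lambda>c B. Just (JConst c) B) cs A"

text \<open>Downward closure only concerns chains of length at least two, since every element
  carries at least one constant.\<close>

definition constant_specification :: "logic \<Rightarrow> ('v, 'c, 'p) fm set \<Rightarrow> bool" where
  "constant_specification L CS \<longleftrightarrow>
     (if has_j4 L
      then \<forall>F\<in>CS. \<exists>c A. axiom_instance L A \<and> F = Just (JConst c) A
      else (\<forall>F\<in>CS. \<exists>cs A. cs \<noteq> [] \<and> axiom_instance L A \<and> F = just_chain cs A) \<and>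
           (\<forall>c cs A. cs \<noteq> [] \<and> axiom_instance L A \<and> just_chain (c # cs) A \<in> CS
              \<longrightarrow> just_chain cs A \<in> CS))"


section \<open>The labeled language\<close>

type_synonym label = nat

datatype ('v, 'c, 'p) lfm =
    Forces label "('v, 'c, 'p) fm"  (infix "\<tturnstile>" 60)
  | Rel label label
  | Evid label "('v, 'c) tm" "('v, 'c, 'p) fm"

datatype ('v, 'c, 'p) sequent =
  Sequent (antecedent: "('v, 'c, 'p) lfm multiset") (succedent: "('v, 'c, 'p) lfm multiset")
    (infix "\<longmapsto>" 50)

primrec labels :: "('v, 'c, 'p) lfm \<Rightarrow> label set" where
  "labels (w \<tturnstile> A) = {w}"
| "labels (Rel w v) = {w, v}"
| "labels (Evid w t A) = {w}"

primrec lfm_in :: "logic \<Rightarrow> ('v, 'c, 'p) lfm \<Rightarrow> bool" where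
  "lfm_in L (w \<tturnstile> A) \<longleftrightarrow> fm_in L A"
| "lfm_in L (Rel w v) \<longleftrightarrow> True"
| "lfm_in L (Evid w t A) \<longleftrightarrow> tm_in L t \<and> fm_in L A"

definition occurring :: "('v, 'c, 'p) sequent \<Rightarrow> ('v, 'c, 'p) lfm set" where
  "occurring S = set_mset (antecedent S) \<union> set_mset (succedent S)"

definition fresh :: "label \<Rightarrow> ('v, 'c, 'p) sequent \<Rightarrow> bool" where
  "fresh v S \<longleftrightarrow> (\<forall>x\<in>occurring S. v \<notin> labels x)"

definition sequent_in :: "logic \<Rightarrow> ('v, 'c, 'p) sequent \<Rightarrow> bool" where
  "sequent_in L S \<longleftrightarrow> (\<forall>x\<in>occurring S. lfm_in L x)"

text \<open>\<open>labeled_subfms A w\<close> is the set of labeled-subformulas of \<open>w \<tturnstile> A\<close>.\<close>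

primrec labeled_subfms :: "('v, 'c, 'p) fm \<Rightarrow> label \<Rightarrow> ('v, 'c, 'p) lfm set" where
  "labeled_subfms (PVar P) w = {w \<tturnstile> PVar P}"
| "labeled_subfms Bot w = {w \<tturnstile> Bot}"
| "labeled_subfms (Neg A) w = {w \<tturnstile> Neg A} \<union> labeled_subfms A w"
| "labeled_subfms (Conj A B) w =
     {w \<tturnstile> Conj A B} \<union> labeled_subfms A w \<union> labeled_subfms B w"
| "labeled_subfms (Disj A B) w =
     {w \<tturnstile> Disj A B} \<union> labeled_subfms A w \<union> labeled_subfms B w"
| "labeled_subfms (Imp A B) w =
     {w \<tturnstile> Imp A B} \<union> labeled_subfms A w \<union> labeled_subfms B w"
| "labeled_subfms (Just t A) w = {w \<tturnstile> Just t A} \<union> (\<Union>v. labeled_subfms A v)"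


section \<open>The calculus\<close>

inductive initial :: "('v, 'c, 'p) sequent \<Rightarrow> bool" where
  init_prop: "initial (add_mset (w \<tturnstile> PVar P) \<Gamma> \<longmapsto> add_mset (w \<tturnstile> PVar P) \<Delta>)"
| init_bot: "initial (add_mset (w \<tturnstile> Bot) \<Gamma> \<longmapsto> \<Delta>)"
| init_rel: "initial (add_mset (Rel w v) \<Gamma> \<longmapsto> add_mset (Rel w v) \<Delta>)"
| init_evid: "initial (add_mset (Evid w t A) \<Gamma> \<longmapsto> add_mset (Evid w t A) \<Delta>)"

text \<open>\<open>rule_instance L CS premises conclusion\<close>\<close>

inductive rule_instance ::
  "logic \<Rightarrow> ('v, 'c, 'p) fm set \<Rightarrow> ('v, 'c, 'p) sequent list \<Rightarrow> ('v, 'c, 'p) sequent \<Rightarrow> bool"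
  for L :: logic and CS :: "('v, 'c, 'p) fm set" where
  L_Neg: "rule_instance L CS
    [\<Gamma> \<longmapsto> add_mset (w \<tturnstile> A) \<Delta>]
    (add_mset (w \<tturnstile> Neg A) \<Gamma> \<longmapsto> \<Delta>)"
| R_Neg: "rule_instance L CS
    [add_mset (w \<tturnstile> A) \<Gamma> \<longmapsto> \<Delta>]
    (\<Gamma> \<longmapsto> add_mset (w \<tturnstile> Neg A) \<Delta>)"
| L_Conj: "rule_instance L CS
    [add_mset (w \<tturnstile> A) (add_mset (w \<tturnstile> B) \<Gamma>) \<longmapsto> \<Delta>]
    (add_mset (w \<tturnstile> Conj A B) \<Gamma> \<longmapsto> \<Delta>)"
| R_Conj: "rule_instance L CS
    [\<Gamma> \<longmapsto> add_mset (w \<tturnstile> A) \<Delta>, \<Gamma> \<longmapsto> add_mset (w \<tturnstile> B) \<Delta>]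
    (\<Gamma> \<longmapsto> add_mset (w \<tturnstile> Conj A B) \<Delta>)"
| L_Disj: "rule_instance L CS
    [add_mset (w \<tturnstile> A) \<Gamma> \<longmapsto> \<Delta>, add_mset (w \<tturnstile> B) \<Gamma> \<longmapsto> \<Delta>]
    (add_mset (w \<tturnstile> Disj A B) \<Gamma> \<longmapsto> \<Delta>)"
| R_Disj: "rule_instance L CS
    [\<Gamma> \<longmapsto> add_mset (w \<tturnstile> A) (add_mset (w \<tturnstile> B) \<Delta>)]
    (\<Gamma> \<longmapsto> add_mset (w \<tturnstile> Disj A B) \<Delta>)"
| L_Imp: "rule_instance L CS
    [\<Gamma> \<longmapsto> add_mset (w \<tturnstile> A) \<Delta>, add_mset (w \<tturnstile> B) \<Gamma> \<longmapsto> \<Delta>]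
    (add_mset (w \<tturnstile> Imp A B) \<Gamma> \<longmapsto> \<Delta>)"
| R_Imp: "rule_instance L CS
    [add_mset (w \<tturnstile> A) \<Gamma> \<longmapsto> add_mset (w \<tturnstile> B) \<Delta>]
    (\<Gamma> \<longmapsto> add_mset (w \<tturnstile> Imp A B) \<Delta>)"
| L_Just: "rule_instance L CS
    [add_mset (v \<tturnstile> A) (add_mset (w \<tturnstile> Just t A) (add_mset (Rel w v) \<Gamma>)) \<longmapsto> \<Delta>]
    (add_mset (w \<tturnstile> Just t A) (add_mset (Rel w v) \<Gamma>) \<longmapsto> \<Delta>)"
| R_Just: "fresh v (add_mset (Evid w t A) \<Gamma> \<longmapsto> add_mset (w \<tturnstile> Just t A) \<Delta>) \<Longrightarrow>
    rule_instance L CS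
    [add_mset (Rel w v) (add_mset (Evid w t A) \<Gamma>) \<longmapsto> add_mset (v \<tturnstile> A) \<Delta>]
    (add_mset (Evid w t A) \<Gamma> \<longmapsto> add_mset (w \<tturnstile> Just t A) \<Delta>)"
| E: "rule_instance L CS
    [add_mset (Evid w t A) (add_mset (w \<tturnstile> Just t A) \<Gamma>) \<longmapsto> \<Delta>]
    (add_mset (w \<tturnstile> Just t A) \<Gamma> \<longmapsto> \<Delta>)"
| El_Sum: "rule_instance L CS
    [add_mset (Evid w (JSum s t) A) (add_mset (Evid w t A) \<Gamma>) \<longmapsto> \<Delta>]
    (add_mset (Evid w t A) \<Gamma> \<longmapsto> \<Delta>)"
| Er_Sum: "rule_instance L CS
    [add_mset (Evid w (JSum t s) A) (add_mset (Evid w t A) \<Gamma>) \<longmapsto> \<Delta>]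
    (add_mset (Evid w t A) \<Gamma> \<longmapsto> \<Delta>)"
| E_App: "rule_instance L CS
    [add_mset (Evid w (JApp s t) B)
       (add_mset (Evid w s (Imp A B)) (add_mset (Evid w t A) \<Gamma>)) \<longmapsto> \<Delta>]
    (add_mset (Evid w s (Imp A B)) (add_mset (Evid w t A) \<Gamma>) \<longmapsto> \<Delta>)"
| AN: "Just (JConst c) F \<in> CS \<Longrightarrow>
    rule_instance L CS
    [add_mset (Evid w (JConst c) F) \<Gamma> \<longmapsto> \<Delta>]
    (\<Gamma> \<longmapsto> \<Delta>)"
| Ref: "has_jT L \<Longrightarrow>
    rule_instance L CS
    [add_mset (Rel w w) \<Gamma> \<longmapsto> \<Delta>]
    (\<Gamma> \<longmapsto> \<Delta>)"
| Ser: "has_jD L \<Longrightarrow> fresh v (\<Gamma> \<longmapsto> \<Delta>) \<Longrightarrow>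
    rule_instance L CS
    [add_mset (Rel w v) \<Gamma> \<longmapsto> \<Delta>]
    (\<Gamma> \<longmapsto> \<Delta>)"
| E_Bang: "has_j4 L \<Longrightarrow>
    rule_instance L CS
    [add_mset (Evid w (JBang t) (Just t A)) (add_mset (Evid w t A) \<Gamma>) \<longmapsto> \<Delta>]
    (add_mset (Evid w t A) \<Gamma> \<longmapsto> \<Delta>)"
| Mon: "has_j4 L \<Longrightarrow>
    rule_instance L CS
    [add_mset (Evid v t A) (add_mset (Evid w t A) (add_mset (Rel w v) \<Gamma>)) \<longmapsto> \<Delta>]
    (add_mset (Evid w t A) (add_mset (Rel w v) \<Gamma>) \<longmapsto> \<Delta>)"
| Trans: "has_j4 L \<Longrightarrow>
    rule_instance L CS
    [add_mset (Rel w u) (add_mset (Rel w v) (add_mset (Rel v u) \<Gamma>)) \<longmapsto> \<Delta>]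
    (add_mset (Rel w v) (add_mset (Rel v u) \<Gamma>) \<longmapsto> \<Delta>)"

text \<open>For a tree \<open>d\<close> of sequents, \<open>nodes d\<close> is the set of all sequents labelling its nodes.\<close>

datatype (nodes: 'a) tree = Node (root: 'a) (children: "'a tree list")

inductive derivation ::
  "logic \<Rightarrow> ('v, 'c, 'p) fm set \<Rightarrow> ('v, 'c, 'p) sequent tree \<Rightarrow> bool"
  for L :: logic and CS :: "('v, 'c, 'p) fm set" where
  leaf: "initial S \<Longrightarrow> sequent_in L S \<Longrightarrow> derivation L CS (Node S [])"
| step: "rule_instance L CS (map root ds) S \<Longrightarrow> sequent_in L S \<Longrightarrow>
    (\<forall>d\<in>set ds. derivation L CS d) \<Longrightarrow> derivation L CS (Node S ds)"

end

theory Submission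
  imports Defs
begin

text \<open>
  The property is the subformula property of a calculus without cut. Read from conclusion to
  premises, a rule only adds relational atoms, evidence atoms, and labeled formulas that are
  immediate labeled-subformulas of a principal one
  (\<open>rule_premise_in_subfm_closure\<close>). The two rules for \<open>t:A\<close> change
  the label, from \<open>w \<tturnstile> t:A\<close> to \<open>v \<tturnstile> A\<close>; the labeled-subformulas of
  \<open>w \<tturnstile> t:A\<close> include the formulas \<open>v \<tturnstile> A\<close> for all \<open>v\<close> exactly to allow for this. Formulas
  that a constant specification or the operations on terms bring in from outside, for instance
  by (AN) or (E\<open>\<cdot>\<close>), only ever sit inside evidence atoms, and no rule read upwards takes a
  formula out of an evidence atom. Since being a labeled-subformula is transitive
  (\<open>labeled_subfms_trans\<close>), the bound for one inference propagates from the endsequent to every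
  node of the derivation.
\<close>

lemma labeled_subfms_refl: "w \<tturnstile> A \<in> labeled_subfms A w"
  by (cases A) auto

text \<open>In the case \<open>t:A\<close> the label may change on the way down, so the induction on the outer
  formula has to leave its label arbitrary.\<close>

lemma labeled_subfms_trans:
  assumes "v \<tturnstile> B \<in> labeled_subfms A w"
  shows "labeled_subfms B v \<subseteq> labeled_subfms A w"
  using assms
proof (induction A arbitrary: w)
  case (Just t A)
  show ?case
  proof (cases "v \<tturnstile> B = w \<tturnstile> Just t A")
    case True
    then show ?thesis by simp
  next
    case False
    then obtain u where "v \<tturnstile> B \<in> labeled_subfms A u"
      using Just.prems by auto
    then have "labeled_subfms B v \<subseteq> labeled_subfms A u"
      by (rule Just.IH)
    then show ?thesis by auto
  qed
qed auto

text \<open>Evidence and relational atoms are put into the closure unconditionally: this makes the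
  conclusion of the theorem an inclusion of sets, which composes along the branches of a
  derivation.\<close>

definition subfm_closure :: "('v, 'c, 'p) lfm set \<Rightarrow> ('v, 'c, 'p) lfm set" where
  "subfm_closure X =
     {x. (\<exists>w A. w \<tturnstile> A \<in> X \<and> x \<in> labeled_subfms A w) \<or>
         (\<exists>w t A. x = Evid w t A) \<or> (\<exists>w v. x = Rel w v)}"

lemma Evid_in_subfm_closure [simp]: "Evid w t A \<in> subfm_closure X"
  and Rel_in_subfm_closure [simp]: "Rel w v \<in> subfm_closure X"
  by (simp_all add: subfm_closure_def)

lemma subfm_closure_extensive: "X \<subseteq> subfm_closure X"
proof
  fix x
  assume "x \<in> X"
  then show "x \<in> subfm_closure X"
    by (cases x) (auto simp: subfm_closure_def intro: labeled_subfms_refl)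
qed

lemma subfm_closure_least:
  assumes "X \<subseteq> subfm_closure Y"
  shows "subfm_closure X \<subseteq> subfm_closure Y"
proof
  fix x
  assume "x \<in> subfm_closure X"
  then consider (sub) w A where "w \<tturnstile> A \<in> X" "x \<in> labeled_subfms A w"
    | (evid) w t A where "x = Evid w t A" | (rel) w v where "x = Rel w v"
    unfolding subfm_closure_def by blast
  then show "x \<in> subfm_closure Y"
  proof cases
    case sub
    then have "w \<tturnstile> A \<in> subfm_closure Y"
      using assms by blast
    then obtain u B where "u \<tturnstile> B \<in> Y" "w \<tturnstile> A \<in> labeled_subfms B u"
      unfolding subfm_closure_def by blast
    with sub(2) show ?thesis
      using labeled_subfms_trans unfolding subfm_closure_def by blast
  qed simp_all
qed

lemma subfm_closure_insert [simp]:
  "subfm_closure (insert (w \<tturnstile> A) X) = labeled_subfms A w \<union> subfm_closure X"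
  "subfm_closure (insert (Evid w t A) X) = subfm_closure X"
  "subfm_closure (insert (Rel w v) X) = subfm_closure X"
  unfolding subfm_closure_def by auto

text \<open>The local form of the subformula property. Formulas of the context recur in the
  conclusion, so extensivity of the closure disposes of them; an active formula is either a
  relational or evidence atom or a labeled-subformula of the principal formula.\<close>

lemma rule_premise_in_subfm_closure:
  assumes "rule_instance L CS premises S" and "T \<in> set premises"
  shows "occurring T \<subseteq> subfm_closure (occurring S)"
  using assms
  by (induction rule: rule_instance.induct)
    (auto simp: occurring_def labeled_subfms_refl
      intro: labeled_subfms_refl subsetD[OF subfm_closure_extensive])

lemma derivation_node_in_subfm_closure:
  assumes "derivation L CS d" and "S \<in> nodes d"
  shows "occurring S \<subseteq> subfm_closure (occurring (root d))"
  using assms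
proof (induction arbitrary: S rule: derivation.induct)
  case (leaf R)
  then show ?case
    using subfm_closure_extensive by auto
next
  case (step ds R)
  show ?case
  proof (cases "S = R")
    case True
    then show ?thesis
      using subfm_closure_extensive by auto
  next
    case False
    then obtain e where e: "e \<in> set ds" "S \<in> nodes e"
      using step.prems by auto
    have "occurring S \<subseteq> subfm_closure (occurring (root e))"
      using step.IH e by blast
    also have "\<dots> \<subseteq> subfm_closure (occurring R)"
      using rule_premise_in_subfm_closure[OF step.hyps(1)] e(1)
      by (intro subfm_closure_least) simp
    finally show ?thesis by simp
  qed
qed

theorem proposition6p2:
  fixes L :: logic
    and CS :: "('v, 'c, 'p) fm set"
    and d :: "('v, 'c, 'p) sequent tree"
  assumes "constant_specification L CS"
    and "derivation L CS d"
  shows "\<forall>S\<in>nodes d. \<forall>x\<in>occurring S.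
    (\<exists>w A. w \<tturnstile> A \<in> occurring (root d) \<and> x \<in> labeled_subfms A w) \<or>
    (\<exists>w t A. x = Evid w t A) \<or>
    (\<exists>w v. x = Rel w v)"
  using derivation_node_in_subfm_closure[OF assms(2)]
  unfolding subfm_closure_def by blast

end
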